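(* For every $n\geq 0$ and every $P\in\mathcal{D}_n^{h,\geq}$, $$\#UDD(P)=\#FD(\phi(P))+\#UD(\phi(P))+\#FUU(\phi(P))+\#FUF(\phi(P)).$$
   Context: A Motzkin path of length $n$ is a word in the steps $U=(1,1)$, $D=(1,-1)$, $F=(1,0)$ forming a lattice path from $(0,0)$ to $(n,0)$ never going below the $x$-axis; $\mathcal{M}_n$ is the set of them. A Dyck path of semilength $n$ is a Motzkin path of length $2n$ without $F$ steps. Every nonempty Dyck path has a unique first return decomposition $P=U\alpha D\beta$ with $\alpha,\beta$ Dyck paths; $h$ denotes maximal height. $\mathcal{D}^{h,\geq}$ is defined recursively: it contains the empty path $\epsilon$, and $P=U\alpha D\beta$ belongs to it iff $\alpha,\beta\in\mathcal{D}^{h,\geq}$ and $h(U\alpha D)\geq h(\beta)$; $\mathcal{D}_n^{h,\geq}$ is the subset of semilength $n$. The bijection $\phi:\mathcal{D}_n^{h,\geq}\to\mathcal{M}_n$ is defined by $\phi(\epsilon)=\epsilon$, $\phi(\alpha UD)=\phi(\alpha)F$, $\phi(\alpha UU\beta D\gamma D)=\phi(\alpha)\phi(\gamma)U\phi(\beta)D$. For a word $X$, $\#X(P)$ is the number of occurrences of $X$ as consecutive steps in $P$. *)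

theory Defs
  imports Main
begin

datatype step = U | D | F

primrec rise :: "step \<Rightarrow> int" where
  "rise U = 1"
| "rise D = - 1"
| "rise F = 0"

definition level :: "step list \<Rightarrow> int" where
  "level w = sum_list (map rise w)"

text \<open>
  Every step advances by one unit horizontally, so the path of \<open>w\<close> from \<open>(0,0)\<close> visits the
  points \<open>(k, level (take k w))\<close> for \<open>k \<le> length w\<close>.
\<close>

definition motzkin_paths :: "nat \<Rightarrow> step list set" where
  "motzkin_paths n =
     {w. length w = n \<and> level w = 0 \<and> (\<forall>k\<le>length w. 0 \<le> level (take k w))}"

definition dyck_paths :: "nat \<Rightarrow> step list set" where
  "dyck_paths n = {w \<in> motzkin_paths (2 * n). F \<notin> set w}"

definition dyck :: "step list \<Rightarrow> bool" where
  "dyck w \<longleftrightarrow> (\<exists>n. w \<in> dyck_paths n)"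

definition height :: "step list \<Rightarrow> int" where
  "height w = Max ((\<lambda>k. level (take k w)) ` {..length w})"

inductive_set dyck_h_geq :: "step list set" where
  empty: "[] \<in> dyck_h_geq"
| first_return:
    "\<lbrakk>dyck \<alpha>; dyck \<beta>; \<alpha> \<in> dyck_h_geq; \<beta> \<in> dyck_h_geq; height (U # \<alpha> @ [D]) \<ge> height \<beta>\<rbrakk>
      \<Longrightarrow> U # \<alpha> @ [D] @ \<beta> \<in> dyck_h_geq"

definition dyck_h_geq_paths :: "nat \<Rightarrow> step list set" where
  "dyck_h_geq_paths n = dyck_paths n \<inter> dyck_h_geq"

definition occurrences :: "'a list \<Rightarrow> 'a list \<Rightarrow> nat" where
  "occurrences X w = card {i. i + length X \<le> length w \<and> take (length X) (drop i w) = X}"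

lemma level_simps [simp]:
  "level [] = 0" "level (s # w) = rise s + level w" "level (v @ w) = level v + level w"
  by (simp_all add: level_def)

lemma level_parity: "F \<notin> set w \<Longrightarrow> even (level w) = even (length w)"
proof (induction w)
  case (Cons s w)
  then show ?case by (cases s) auto
qed simp

lemma dyck_iff:
  "dyck w \<longleftrightarrow> F \<notin> set w \<and> level w = 0 \<and> (\<forall>u v. w = u @ v \<longrightarrow> 0 \<le> level u)"
proof -
  have 1: "(\<forall>k\<le>length w. 0 \<le> level (take k w)) \<longleftrightarrow> (\<forall>u v. w = u @ v \<longrightarrow> 0 \<le> level u)"
    by (metis append_eq_conv_conj append_take_drop_id le_add1 length_append)
  have 2: "(\<exists>n. length w = 2 * n) \<longleftrightarrow> even (length w)"
    by auto
  show ?thesis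
    unfolding dyck_def dyck_paths_def motzkin_paths_def mem_Collect_eq 1
    using 2 level_parity[of w] by auto
qed

lemma dyck_Nil [simp]: "dyck []"
  by (simp add: dyck_iff)

lemma last_return_unique:
  assumes eq: "\<alpha> @ U # \<delta> @ [D] = \<alpha>' @ U # \<delta>' @ [D]"
    and d: "dyck \<alpha>" "dyck \<delta>" "dyck \<alpha>'" "dyck \<delta>'"
  shows "\<alpha> = \<alpha>' \<and> \<delta> = \<delta>'"
proof -
  have no: False if e: "y @ x # xs = y'" "x # xs @ U # z' = U # z" and dd: "dyck y" "dyck z" "dyck y'"
    for y y' z z' x xs
  proof -
    have "x = U" "z = xs @ U # z'" using e by auto
    then have "0 \<le> level xs" using dd by (auto simp: dyck_iff)
    moreover have "level y' = level y + 1 + level xs" using e \<open>x = U\<close> by auto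
    ultimately show False using dd by (auto simp: dyck_iff)
  qed
  have "\<alpha> @ U # \<delta> = \<alpha>' @ U # \<delta>'" using eq by (metis append_Cons append_assoc append1_eq_conv)
  then obtain us where "\<alpha> = \<alpha>' @ us \<and> us @ U # \<delta> = U # \<delta>' \<or> \<alpha> @ us = \<alpha>' \<and> U # \<delta> = us @ U # \<delta>'"
    unfolding append_eq_append_conv2 by blast
  then show ?thesis
  proof (elim disjE conjE)
    assume a: "\<alpha> = \<alpha>' @ us" "us @ U # \<delta> = U # \<delta>'"
    show ?thesis
    proof (cases us)
      case (Cons x xs)
      then show ?thesis using no[of \<alpha>' x xs \<alpha> \<delta> \<delta>'] a d by auto
    qed (use a in auto)
  next
    assume a: "\<alpha> @ us = \<alpha>'" "U # \<delta> = us @ U # \<delta>'"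
    show ?thesis
    proof (cases us)
      case (Cons x xs)
      then show ?thesis using no[of \<alpha> x xs \<alpha>' \<delta>' \<delta>] a d by auto
    qed (use a in auto)
  qed
qed

lemma first_return_unique:
  assumes eq: "\<beta> @ D # \<gamma> = \<beta>' @ D # \<gamma>'" and d: "dyck \<beta>" "dyck \<beta>'"
  shows "\<beta> = \<beta>' \<and> \<gamma> = \<gamma>'"
proof -
  have no: False if "y @ x # xs = y'" "x # xs @ z' = D # z" and dd: "dyck y" "dyck y'"
    for y y' z z' x xs
  proof -
    have "y' = (y @ [D]) @ xs" using that by auto
    then have "0 \<le> level (y @ [D])" using dd unfolding dyck_iff by blast
    then show False using dd by (auto simp: dyck_iff)
  qed
  obtain us where "\<beta> = \<beta>' @ us \<and> us @ D # \<gamma> = D # \<gamma>' \<or> \<beta> @ us = \<beta>' \<and> D # \<gamma> = us @ D # \<gamma>'"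
    using eq unfolding append_eq_append_conv2 by blast
  then show ?thesis
  proof (elim disjE conjE)
    assume a: "\<beta> = \<beta>' @ us" "us @ D # \<gamma> = D # \<gamma>'"
    show ?thesis
    proof (cases us)
      case (Cons x xs)
      then show ?thesis using no[of \<beta>' x xs \<beta> "D # \<gamma>" \<gamma>'] a d by auto
    qed (use a in auto)
  next
    assume a: "\<beta> @ us = \<beta>'" "D # \<gamma> = us @ D # \<gamma>'"
    show ?thesis
    proof (cases us)
      case (Cons x xs)
      then show ?thesis using no[of \<beta> x xs \<beta>' "D # \<gamma>'" \<gamma>] a d by auto
    qed (use a in auto)
  qed
qed

lemma last_return_exists:
  assumes "dyck P" "P \<noteq> []"
  obtains \<alpha> \<delta> where "P = \<alpha> @ U # \<delta> @ [D]" "dyck \<alpha>" "dyck \<delta>"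
proof -
  let ?Q = "\<lambda>k. k < length P \<and> level (take k P) = 0"
  define k where "k = (GREATEST k. ?Q k)"
  have "?Q 0" using assms by simp
  then have k: "?Q k" unfolding k_def by (rule GreatestI_nat[where b = "length P"]) auto
  have kmax: "j \<le> k" if "?Q j" for j
    unfolding k_def using that by (rule Greatest_le_nat[where b = "length P"]) auto
  define \<alpha> where "\<alpha> = take k P"
  obtain s r where P: "P = \<alpha> @ s # r" and l: "length \<alpha> = k"
    using k by (metis \<alpha>_def id_take_nth_drop length_take less_imp_le_nat min.absorb2)
  have a0: "level \<alpha> = 0" using k \<alpha>_def by simp
  have F: "F \<notin> set P" and nn: "\<And>u v. P = u @ v \<Longrightarrow> 0 \<le> level u" and P0: "level P = 0"
    using assms unfolding dyck_iff by blast+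
  have pos: "0 < level (s # u)" if "r = u @ v" "v \<noteq> []" for u v
  proof -
    have "level (\<alpha> @ s # u) \<noteq> 0"
    proof
      assume "level (\<alpha> @ s # u) = 0"
      moreover have "take (length (\<alpha> @ s # u)) P = \<alpha> @ s # u" using P that by simp
      ultimately have "length (\<alpha> @ s # u) \<le> k"
        by (intro kmax) (use P that in auto)
      then show False using l by simp
    qed
    moreover have "0 \<le> level (\<alpha> @ s # u)" using nn[of "\<alpha> @ s # u" v] P that by simp
    ultimately show ?thesis using a0 by simp
  qed
  have s: "s = U"
  proof (cases s)
    case D
    then show ?thesis using nn[of "\<alpha> @ [s]" r] P a0 by simp
  next
    case F
    then show ?thesis using \<open>F \<notin> set P\<close> P by simp
  qed
  have "r \<noteq> []" using P0 P a0 s by auto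
  then obtain \<delta> t where r: "r = \<delta> @ [t]" by (metis rev_exhaust)
  have lt: "1 + level \<delta> > 0" using pos[of \<delta> "[t]"] r s by simp
  have sum: "1 + level \<delta> + rise t = 0" using P0 P a0 s r by simp
  have t: "t = D" using lt sum by (cases t) auto
  have "dyck \<alpha>"
    unfolding dyck_iff using F P a0 nn by auto
  moreover have "dyck \<delta>"
    unfolding dyck_iff
  proof (intro conjI allI impI)
    show "F \<notin> set \<delta>" using F P r by auto
    show "level \<delta> = 0" using sum t by simp
    fix u v assume "\<delta> = u @ v"
    then show "0 \<le> level u" using pos[of u "v @ [t]"] r s by simp
  qed
  ultimately show thesis using that P s r t by simp
qed

lemma first_return_exists:
  assumes "dyck P" "P \<noteq> []"
  obtains \<beta> \<gamma> where "P = U # \<beta> @ D # \<gamma>" "dyck \<beta>" "dyck \<gamma>"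
  using assms
proof (induction "length P" arbitrary: P thesis rule: less_induct)
  case less
  obtain \<alpha> \<delta> where P: "P = \<alpha> @ U # \<delta> @ [D]" "dyck \<alpha>" "dyck \<delta>"
    using last_return_exists less.prems(2,3) by blast
  show ?case
  proof (cases "\<alpha> = []")
    case True
    then show ?thesis using less.prems(1)[of \<delta> "[]"] P by simp
  next
    case False
    then obtain \<beta> \<gamma> where A: "\<alpha> = U # \<beta> @ D # \<gamma>" "dyck \<beta>" "dyck \<gamma>"
      using less.hyps[of \<alpha>] P by auto
    have "dyck (\<gamma> @ U # \<delta> @ [D])"
      unfolding dyck_iff
    proof (intro conjI allI impI)
      show "F \<notin> set (\<gamma> @ U # \<delta> @ [D])" using A P by (auto simp: dyck_iff)
      show "level (\<gamma> @ U # \<delta> @ [D]) = 0" using A P by (auto simp: dyck_iff)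
      fix u v assume "\<gamma> @ U # \<delta> @ [D] = u @ v"
      then have "P = (U # \<beta> @ D # u) @ v" using A P by simp
      then have "0 \<le> level (U # \<beta> @ D # u)" using \<open>dyck P\<close> unfolding dyck_iff by blast
      then show "0 \<le> level u" using A by (simp add: dyck_iff)
    qed
    then show ?thesis using less.prems(1)[of \<beta> "\<gamma> @ U # \<delta> @ [D]"] A P by simp
  qed
qed

text \<open>
  The recursion makes sense for all Dyck words, and it is stated for these; the map under
  consideration is its restriction to \<open>dyck_h_geq\<close>. The recursive calls do not leave that set:
  a Dyck word is in \<open>dyck_h_geq\<close> iff its components \<open>U \<delta> D\<close> between consecutive returns have weakly
  decreasing heights and all interiors \<open>\<delta>\<close> are in \<open>dyck_h_geq\<close>, so the set is closed under taking
  prefixes and suffixes of components and under passing to an interior. The value \<open>[]\<close> on words that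
  are not Dyck words is a dummy.
\<close>

function phi :: "step list \<Rightarrow> step list" where
  "phi [] = []"
| "dyck \<alpha> \<Longrightarrow> phi (\<alpha> @ [U, D]) = phi \<alpha> @ [F]"
| "\<lbrakk>dyck \<alpha>; dyck \<beta>; dyck \<gamma>\<rbrakk> \<Longrightarrow>
     phi (\<alpha> @ [U, U] @ \<beta> @ [D] @ \<gamma> @ [D]) = phi \<alpha> @ phi \<gamma> @ [U] @ phi \<beta> @ [D]"
| "\<not> dyck P \<Longrightarrow> phi P = []"
proof -
  have 1: "dyck (\<alpha> @ U # \<delta> @ [D])" if "dyck \<alpha>" "dyck \<delta>" for \<alpha> \<delta>
  proof -
    have "0 \<le> level u" if e: "\<alpha> @ U # \<delta> @ [D] = u @ v" for u v
    proof -
      consider x where "\<alpha> = u @ x" | x y where "u = \<alpha> @ U # x" "\<delta> = x @ y" | "u = \<alpha> @ U # \<delta> @ [D]"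
        using e
        by (auto simp: append_eq_append_conv2 Cons_eq_append_conv append_eq_Cons_conv)
      then show ?thesis using \<open>dyck \<alpha>\<close> \<open>dyck \<delta>\<close> by cases (auto simp: dyck_iff)
    qed
    then show ?thesis using that by (auto simp: dyck_iff)
  qed
  have 2: "dyck (U # \<beta> @ D # \<gamma>)" if "dyck \<beta>" "dyck \<gamma>" for \<beta> \<gamma>
  proof -
    have "0 \<le> level u" if e: "U # \<beta> @ D # \<gamma> = u @ v" for u v
    proof -
      consider "u = []" | x y where "u = U # x" "\<beta> = x @ y" | x y where "u = U # \<beta> @ D # x" "\<gamma> = x @ y"
        using e
        by (auto simp: append_eq_append_conv2 Cons_eq_append_conv append_eq_Cons_conv)
      then show ?thesis using \<open>dyck \<beta>\<close> \<open>dyck \<gamma>\<close> by cases (auto simp: dyck_iff)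
    qed
    then show ?thesis using that by (auto simp: dyck_iff)
  qed
  have A: "dyck (\<alpha> @ [U, D])" if "dyck \<alpha>" for \<alpha>
    using 1[of \<alpha> "[]"] that by simp
  have B: "dyck (\<alpha> @ [U, U] @ \<beta> @ [D] @ \<gamma> @ [D])" if "dyck \<alpha>" "dyck \<beta>" "dyck \<gamma>" for \<alpha> \<beta> \<gamma>
    using 1[of \<alpha> "U # \<beta> @ D # \<gamma>"] 2[of \<beta> \<gamma>] that by simp
  {
    fix Q and x :: "step list"
    assume e: "x = [] \<Longrightarrow> Q" "\<And>\<alpha>. dyck \<alpha> \<Longrightarrow> x = \<alpha> @ [U, D] \<Longrightarrow> Q"
      "\<And>\<alpha> \<beta> \<gamma>. dyck \<alpha> \<Longrightarrow> dyck \<beta> \<Longrightarrow> dyck \<gamma> \<Longrightarrow> x = \<alpha> @ [U, U] @ \<beta> @ [D] @ \<gamma> @ [D] \<Longrightarrow> Q"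
      "\<And>P. \<not> dyck P \<Longrightarrow> x = P \<Longrightarrow> Q"
    show Q
    proof (cases "dyck x \<and> x \<noteq> []")
      case True
      then obtain \<alpha> \<delta> where x: "x = \<alpha> @ U # \<delta> @ [D]" "dyck \<alpha>" "dyck \<delta>"
        using last_return_exists by blast
      show Q
      proof (cases "\<delta> = []")
        case True
        then show Q using e(2) x by simp
      next
        case False
        then obtain \<beta> \<gamma> where "\<delta> = U # \<beta> @ D # \<gamma>" "dyck \<beta>" "dyck \<gamma>"
          using first_return_exists x by blast
        then show Q using e(3) x by simp
      qed
    qed (use e in auto)
  next
    fix \<alpha> \<alpha>' assume "dyck \<alpha>" "dyck \<alpha>'" "\<alpha> @ [U, D] = \<alpha>' @ [U, D]"
    then show "phi_sumC \<alpha> @ [F] = phi_sumC \<alpha>' @ [F]" by simp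
  next
    fix \<alpha> \<alpha>' \<beta> \<gamma>
    assume "dyck \<alpha>" "dyck \<alpha>'" "dyck \<beta>" "dyck \<gamma>"
      and "\<alpha> @ [U, D] = \<alpha>' @ [U, U] @ \<beta> @ [D] @ \<gamma> @ [D]"
    then have False
      using last_return_unique[of \<alpha> "[]" \<alpha>' "U # \<beta> @ D # \<gamma>"] 2 by auto
    then show "phi_sumC \<alpha> @ [F] = phi_sumC \<alpha>' @ phi_sumC \<gamma> @ [U] @ phi_sumC \<beta> @ [D]" ..
  next
    fix \<alpha> P assume "dyck \<alpha>" "\<not> dyck P" "\<alpha> @ [U, D] = P"
    then show "phi_sumC \<alpha> @ [F] = []" using A by blast
  next
    fix \<alpha> \<beta> \<gamma> \<alpha>' \<beta>' \<gamma>'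
    assume d: "dyck \<alpha>" "dyck \<beta>" "dyck \<gamma>" "dyck \<alpha>'" "dyck \<beta>'" "dyck \<gamma>'"
      and e: "\<alpha> @ [U, U] @ \<beta> @ [D] @ \<gamma> @ [D] = \<alpha>' @ [U, U] @ \<beta>' @ [D] @ \<gamma>' @ [D]"
    then have "\<alpha> = \<alpha>'" "\<beta> @ D # \<gamma> = \<beta>' @ D # \<gamma>'"
      using last_return_unique[of \<alpha> "U # \<beta> @ D # \<gamma>" \<alpha>' "U # \<beta>' @ D # \<gamma>'"] 2 by auto
    moreover from this(2) have "\<beta> = \<beta>'" "\<gamma> = \<gamma>'"
      using first_return_unique d by blast+
    ultimately show "phi_sumC \<alpha> @ phi_sumC \<gamma> @ [U] @ phi_sumC \<beta> @ [D] =
        phi_sumC \<alpha>' @ phi_sumC \<gamma>' @ [U] @ phi_sumC \<beta>' @ [D]" by simp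
  next
    fix \<alpha> \<beta> \<gamma> P
    assume "dyck \<alpha>" "dyck \<beta>" "dyck \<gamma>" "\<not> dyck P" "\<alpha> @ [U, U] @ \<beta> @ [D] @ \<gamma> @ [D] = P"
    then show "phi_sumC \<alpha> @ phi_sumC \<gamma> @ [U] @ phi_sumC \<beta> @ [D] = []" using B by blast
  }
qed auto
termination
  by (relation "measure length") auto

end

theory Submission
  imports Defs "HOL-Library.Sublist"
begin

text \<open>
  Both sides are computed along the recursion of \<open>phi\<close>. For \<open>P = \<alpha> U U \<beta> D \<gamma> D\<close> the height
  condition forces that \<open>\<alpha>\<close> does not end in \<open>U D\<close>, and that \<open>\<gamma>\<close> is empty or ends in \<open>U D\<close> whenever
  \<open>\<beta>\<close> is empty. Since \<open>phi w\<close> ends in \<open>F\<close> exactly when \<open>w\<close> ends in \<open>U D\<close>, the occurrences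
  that straddle the factors of \<open>P\<close> and of \<open>phi P\<close> then agree in number: \<open>[\<beta> ends in U D]\<close> matches the
  new \<open>F D\<close>, \<open>[\<gamma> ends in U D]\<close> matches the new \<open>F U U\<close> or \<open>F U F\<close> (or the new \<open>U D\<close> if \<open>\<beta>\<close> is empty),
  and \<open>[\<beta> = \<gamma> = \<epsilon>]\<close> matches the new \<open>U D\<close>.
\<close>

section \<open>Occurrences\<close>

lemma occurrences_Nil: "X \<noteq> [] \<Longrightarrow> occurrences X [] = 0"
  by (simp add: occurrences_def)

lemma occurrences_Cons:
  assumes "X \<noteq> []"
  shows "occurrences X (a # w) = of_bool (prefix X (a # w)) + occurrences X w"
proof -
  let ?S = "\<lambda>w. {i. i + length X \<le> length w \<and> take (length X) (drop i w) = X}"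
  have fin: "finite (?S w)" for w
    by (rule finite_subset[of _ "{..length w}"]) auto
  have pre: "0 \<in> ?S (a # w) \<longleftrightarrow> prefix X (a # w)"
  proof -
    have "take (length X) (a # w) = X \<longleftrightarrow> prefix X (a # w)"
      by (metis append_eq_conv_conj prefix_def take_is_prefix)
    then show ?thesis
      using prefix_length_le[of X "a # w"] by auto
  qed
  \<comment> \<open>A match at position \<open>i + 1\<close> of \<open>a # w\<close> is a match at
    position \<open>i\<close> of \<open>w\<close>; only position 0 is new.\<close>
  have split: "?S (a # w) = ?S (a # w) \<inter> {0} \<union> Suc ` ?S w"
  proof (intro set_eqI)
    fix i
    show "i \<in> ?S (a # w) \<longleftrightarrow> i \<in> ?S (a # w) \<inter> {0} \<union> Suc ` ?S w"
      by (cases i) auto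
  qed
  have "card (?S (a # w)) = card (?S (a # w) \<inter> {0}) + card (Suc ` ?S w)"
    by (subst split, intro card_Un_disjoint) (use fin in auto)
  also have "card (?S (a # w) \<inter> {0}) = of_bool (prefix X (a # w))"
    by (simp only: Int_insert_right Int_empty_right pre) simp
  finally show ?thesis
    unfolding occurrences_def by (simp add: card_image)
qed

lemma suffix_singleton_Cons: "suffix [x] (a # u) \<longleftrightarrow> (if u = [] then x = a else suffix [x] u)"
  by (auto simp: suffix_Cons)

lemma suffix_doubleton_Cons:
  "suffix [x, y] (a # u) \<longleftrightarrow> (if length u = 1 then [x, y] = a # u else suffix [x, y] u)"
  by (auto simp: suffix_Cons length_Suc_conv)

lemma occurrences_append_2:
  "occurrences [x, y] (u @ v) =
     occurrences [x, y] u + occurrences [x, y] v + of_bool (suffix [x] u \<and> prefix [y] v)"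
proof (induction u)
  case (Cons a u)
  then show ?case
    by (cases u) (auto simp: occurrences_Cons suffix_singleton_Cons occurrences_Nil)
qed (simp add: occurrences_Nil)

text \<open>A match across the cut has two letters on the left and one on the right, or the
  reverse.\<close>

lemma occurrences_append_3:
  "occurrences [x, y, z] (u @ v) =
     occurrences [x, y, z] u + occurrences [x, y, z] v
     + of_bool (suffix [x, y] u \<and> prefix [z] v) + of_bool (suffix [x] u \<and> prefix [y, z] v)"
proof (induction u)
  case (Cons a u)
  show ?case
  proof (cases u)
    case Nil
    then show ?thesis using Cons
      by (auto simp: occurrences_Cons suffix_singleton_Cons suffix_doubleton_Cons occurrences_Nil)
  next
    case (Cons b u')
    then show ?thesis using Cons.IH
      by (cases u')
        (auto simp: occurrences_Cons suffix_singleton_Cons suffix_doubleton_Cons occurrences_Nil)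
  qed
qed (simp add: occurrences_Nil)

section \<open>Heights and the height condition\<close>

lemma height_ge_prefix: "level u \<le> height (u @ v)"
  unfolding height_def by (rule Max_ge) (auto intro!: image_eqI[of _ _ "length u"])

lemma height_append_ge: "height u \<le> height (u @ v)"
proof -
  have "height u \<in> (\<lambda>k. level (take k u)) ` {..length u}"
    unfolding height_def by (rule Max_in) auto
  then obtain k where "height u = level (take k u)"
    by auto
  also have "\<dots> \<le> height (take k u @ drop k u @ v)"
    by (rule height_ge_prefix)
  finally show ?thesis
    unfolding append_assoc[symmetric] append_take_drop_id .
qed

lemma height_UD: "height [U, D] = 1"
proof -
  have "{..length [U, D]} = {0, 1, 2}" by auto
  then show ?thesis unfolding height_def by simp
qed

lemma dyck_first_step:
  assumes "dyck w" "w \<noteq> []"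
  obtains v where "w = U # v"
  using first_return_exists[OF assms] by metis

lemma dyck_last_step:
  assumes "dyck w" "w \<noteq> []"
  obtains v where "w = v @ [D]"
  using last_return_exists[OF assms] by (metis append_Cons append_assoc)

lemma dyck_append:
  assumes "dyck u" "dyck v"
  shows "dyck (u @ v)"
proof -
  have "0 \<le> level x" if "u @ v = x @ y" for x y
    using that assms unfolding dyck_iff append_eq_append_conv2 by fastforce
  then show ?thesis using assms by (auto simp: dyck_iff)
qed

lemma dyck_h_geq_first_returnD:
  assumes "U # \<alpha> @ D # \<beta> \<in> dyck_h_geq" "dyck \<alpha>"
  shows "\<alpha> \<in> dyck_h_geq" "\<beta> \<in> dyck_h_geq" "height \<beta> \<le> height (U # \<alpha> @ [D])"
proof -
  obtain \<alpha>' \<beta>' where *: "U # \<alpha> @ D # \<beta> = U # \<alpha>' @ [D] @ \<beta>'" "dyck \<alpha>'"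
    "\<alpha>' \<in> dyck_h_geq" "\<beta>' \<in> dyck_h_geq" "height \<beta>' \<le> height (U # \<alpha>' @ [D])"
    using assms(1) by (rule dyck_h_geq.cases) auto
  then have "\<alpha> = \<alpha>' \<and> \<beta> = \<beta>'"
    using first_return_unique[of \<alpha> \<beta> \<alpha>' \<beta>'] assms(2) by simp
  then show "\<alpha> \<in> dyck_h_geq" "\<beta> \<in> dyck_h_geq" "height \<beta> \<le> height (U # \<alpha> @ [D])"
    using * by auto
qed

text \<open>Peel first returns off \<open>u\<close>. The height condition survives dropping
  \<open>v\<close>, since \<open>height \<beta>\<close> is at most
  \<open>height (\<beta> @ v)\<close>.\<close>

lemma dyck_h_geq_appendD:
  assumes "u @ v \<in> dyck_h_geq" "dyck u" "dyck v"
  shows "u \<in> dyck_h_geq \<and> v \<in> dyck_h_geq"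
  using assms
proof (induction "length u" arbitrary: u rule: less_induct)
  case less
  show ?case
  proof (cases "u = []")
    case True
    then show ?thesis using less.prems by (simp add: dyck_h_geq.empty)
  next
    case False
    then obtain \<alpha> \<beta> where u: "u = U # \<alpha> @ D # \<beta>" "dyck \<alpha>" "dyck \<beta>"
      using first_return_exists less.prems(2) by metis
    then have *: "\<alpha> \<in> dyck_h_geq" "\<beta> @ v \<in> dyck_h_geq" "height (\<beta> @ v) \<le> height (U # \<alpha> @ [D])"
      using dyck_h_geq_first_returnD[of \<alpha> "\<beta> @ v"] less.prems by simp_all
    then have "\<beta> \<in> dyck_h_geq" "v \<in> dyck_h_geq"
      using less.hyps[of \<beta>] less.prems u by auto
    then show ?thesis
      using dyck_h_geq.first_return[of \<alpha> \<beta>] * u height_append_ge[of \<beta> v] by simp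
  qed
qed

lemma dyck_arch:
  assumes "dyck \<beta>"
  shows "dyck (U # \<beta> @ [D])"
proof -
  have "0 \<le> level x" if "U # \<beta> @ [D] = x @ y" for x y
    using that assms
    by (auto simp: dyck_iff append_eq_append_conv2 Cons_eq_append_conv append_eq_Cons_conv)
  then show ?thesis using assms by (auto simp: dyck_iff)
qed

lemma dyck_first_return:
  assumes "dyck \<beta>" "dyck \<gamma>"
  shows "dyck (U # \<beta> @ D # \<gamma>)"
  using dyck_append[OF dyck_arch assms(2)] assms(1) by simp

text \<open>A final \<open>UD\<close> of \<open>\<alpha>\<close> would be a component of height 1
  directly before \<open>U \<delta> D\<close>, which reaches height 2, against the height
  condition.\<close>

lemma not_suffix_UD:
  assumes "\<alpha> @ U # \<delta> @ [D] \<in> dyck_h_geq" "dyck \<alpha>" "dyck \<delta>" "\<delta> \<noteq> []"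
  shows "\<not> suffix [U, D] \<alpha>"
proof
  assume "suffix [U, D] \<alpha>"
  then obtain \<alpha>' where \<alpha>: "\<alpha> = \<alpha>' @ [U, D]"
    by (auto simp: suffix_def)
  have "0 \<le> level u" if "\<alpha>' = u @ v" for u v
    using assms(2) that \<alpha> by (simp add: dyck_iff)
  then have "dyck \<alpha>'"
    using assms(2) \<alpha> by (auto simp: dyck_iff)
  moreover have "dyck (U # [] @ D # U # \<delta> @ [D])"
    by (intro dyck_first_return dyck_arch dyck_Nil assms)
  ultimately have "U # [] @ D # (U # \<delta> @ [D]) \<in> dyck_h_geq"
    using dyck_h_geq_appendD[of \<alpha>' "U # [] @ D # U # \<delta> @ [D]"] assms(1) \<alpha> by simp
  then have "height (U # \<delta> @ [D]) \<le> 1"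
    using dyck_h_geq_first_returnD(3)[of "[]" "U # \<delta> @ [D]"] height_UD by simp
  moreover obtain v where "\<delta> = U # v"
    using dyck_first_step assms by blast
  ultimately show False
    using height_ge_prefix[of "[U, U]" "v @ [D]"] by simp
qed

lemma suffix_UD_if_height_le_1:
  assumes "dyck \<gamma>" "\<gamma> \<noteq> []" "height \<gamma> \<le> 1"
  shows "suffix [U, D] \<gamma>"
proof -
  obtain \<alpha> \<delta> where \<gamma>: "\<gamma> = \<alpha> @ U # \<delta> @ [D]" "dyck \<alpha>" "dyck \<delta>"
    using last_return_exists assms by blast
  have "\<delta> = []"
  proof (rule ccontr)
    assume "\<delta> \<noteq> []"
    then obtain v where "\<delta> = U # v"
      using dyck_first_step \<gamma> by blast
    then show False
      using height_ge_prefix[of "\<alpha> @ [U, U]" "v @ [D]"] \<gamma> assms(3) by (simp add: dyck_iff)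
  qed
  then show ?thesis using \<gamma> by (simp add: suffix_def)
qed

section \<open>First and last steps of the image\<close>

lemma suffix_singleton_append: "suffix [x] (u @ v) \<longleftrightarrow> (if v = [] then suffix [x] u else suffix [x] v)"
  by (cases v rule: rev_cases) (auto simp flip: append_assoc)

lemma prefix_singleton_append: "prefix [x] (u @ v) \<longleftrightarrow> (if u = [] then prefix [x] v else prefix [x] u)"
  by (cases u) auto

lemma dyck_not_suffix_U: "dyck w \<Longrightarrow> \<not> suffix [U] w"
  by (cases "w = []") (auto elim!: dyck_last_step)

lemma dyck_not_prefix_D: "dyck w \<Longrightarrow> \<not> prefix [D] w"
  by (cases "w = []") (auto elim!: dyck_first_step)

lemma phi_append_arch:
  "\<lbrakk>dyck \<alpha>; dyck \<beta>; dyck \<gamma>\<rbrakk> \<Longrightarrow>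
    phi (\<alpha> @ U # U # \<beta> @ D # \<gamma> @ [D]) = phi \<alpha> @ phi \<gamma> @ U # phi \<beta> @ [D]"
  using phi.simps(3)[of \<alpha> \<beta> \<gamma>] by simp

lemma phi_eq_Nil_iff: "dyck w \<Longrightarrow> phi w = [] \<longleftrightarrow> w = []"
  by (induction w rule: phi.induct) (auto simp: phi_append_arch)

text \<open>In each equation of \<open>phi\<close> the first letter is inherited from a recursive
  value or is \<open>F\<close> or \<open>U\<close>. The dummy value \<open>[]\<close> makes this
  true of all words, not only Dyck words.\<close>

lemma phi_first_step: "\<not> prefix [D] (phi w)"
  by (induction w rule: phi.induct) (auto simp: phi_append_arch prefix_singleton_append)

lemma phi_last_step: "\<not> suffix [U] (phi w)"
  by (induction w rule: phi.induct)
    (auto simp: phi_append_arch suffix_singleton_append suffix_singleton_Cons)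

lemma suffix_F_phi_iff: "dyck w \<Longrightarrow> suffix [F] (phi w) \<longleftrightarrow> suffix [U, D] w"
proof (induction w rule: phi.induct)
  case (3 \<alpha> \<beta> \<gamma>)
  \<comment> \<open>The letter before the final \<open>D\<close> is \<open>D\<close> if
    \<open>\<gamma>\<close> is empty, and otherwise the last letter of \<open>\<gamma>\<close>,
    which is not \<open>U\<close>.\<close>
  have "\<not> suffix [U, D] (\<alpha> @ U # U # \<beta> @ D # \<gamma> @ [D])"
    using snoc_suffix_snoc[of "[U]" D "\<alpha> @ U # U # \<beta> @ D # \<gamma>"] dyck_not_suffix_U[OF 3(3)]
    by (simp add: suffix_singleton_append suffix_singleton_Cons)
  then show ?case
    using 3 by (simp add: phi_append_arch suffix_singleton_append suffix_singleton_Cons)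
qed (auto simp: suffix_append)

section \<open>The two counts\<close>

text \<open>The four counts are summed because the pattern created at a junction varies with the
  neighbouring letters, while the total changes uniformly.\<close>

definition pattern_count :: "step list \<Rightarrow> nat" where
  "pattern_count w = occurrences [F, D] w + occurrences [U, D] w
    + occurrences [F, U, U] w + occurrences [F, U, F] w"

lemma suffix_doubletonD: "suffix [x, y] w \<Longrightarrow> suffix [y] w"
  by (auto simp: suffix_def)

text \<open>A straddling match would leave \<open>F\<close>, \<open>U\<close> or \<open>FU\<close>
  at the end of \<open>u\<close>.\<close>

lemma pattern_count_append:
  assumes "\<not> suffix [F] u" "\<not> suffix [U] u"
  shows "pattern_count (u @ v) = pattern_count u + pattern_count v"
  using assms suffix_doubletonD[of F U u]
  by (auto simp: pattern_count_def occurrences_append_2 occurrences_append_3)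

lemma pattern_count_snoc_F:
  assumes "\<not> suffix [U] u"
  shows "pattern_count (u @ [F]) = pattern_count u"
  using assms suffix_doubletonD[of F U u]
  by (auto simp: pattern_count_def occurrences_append_2 occurrences_append_3 occurrences_Cons occurrences_Nil)

text \<open>Of the four patterns the leading \<open>U\<close> can open only \<open>UD\<close>, which
  forces \<open>u\<close> to be empty; after a nonempty \<open>u\<close> the closing
  \<open>D\<close> can complete only \<open>FD\<close>.\<close>

lemma pattern_count_arch:
  assumes "\<not> suffix [U] u" "\<not> prefix [D] u"
  shows "pattern_count (U # u @ [D]) = pattern_count u + of_bool (u = []) + of_bool (suffix [F] u)"
proof (cases "u = []")
  case True
  then show ?thesis by (simp add: pattern_count_def occurrences_Cons occurrences_Nil)
next
  case False
  moreover have "\<not> suffix [F, U] u"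
    using assms suffix_doubletonD[of F U u] by blast
  ultimately show ?thesis
    using assms
    by (simp add: pattern_count_def occurrences_append_2 occurrences_append_3
        occurrences_Cons occurrences_Nil prefix_singleton_append)
qed

lemma pattern_count_append_arch:
  assumes "\<not> suffix [U] u" "\<not> prefix [D] v"
  shows "pattern_count (u @ U # v @ [D]) =
    pattern_count u + pattern_count (U # v @ [D]) + of_bool (suffix [F] u \<and> v \<noteq> [])"
proof -
  have "\<not> suffix [F, U] u"
    using assms(1) suffix_doubletonD[of F U u] by blast
  \<comment> \<open>A nonempty \<open>v\<close> starts with \<open>U\<close> or \<open>F\<close>, so
    behind a final \<open>F\<close> of \<open>u\<close> exactly one of \<open>FUU\<close> and
    \<open>FUF\<close> arises.\<close>
  moreover have "of_bool (prefix [U] v) + of_bool (prefix [F] v) = (of_bool (v \<noteq> []) :: nat)"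
  proof (cases v)
    case (Cons s w)
    then show ?thesis using assms(2) by (cases s) auto
  qed simp
  ultimately show ?thesis
    using assms
    by (cases "v = []"; cases "suffix [F] u")
      (simp_all add: pattern_count_def occurrences_append_2 occurrences_append_3 prefix_singleton_append)
qed

text \<open>The \<open>D\<close> after \<open>\<beta>\<close> and the \<open>D\<close> after
  \<open>\<gamma>\<close> can each complete a \<open>UD\<close>. The second new \<open>U\<close> is
  followed by \<open>DD\<close> only if nothing separates it from both of these.\<close>

lemma occurrences_UDD_arch:
  assumes "dyck \<alpha>" "dyck \<beta>" "dyck \<gamma>"
  shows "occurrences [U, D, D] (\<alpha> @ U # U # \<beta> @ D # \<gamma> @ [D]) =
    occurrences [U, D, D] \<alpha> + occurrences [U, D, D] \<beta> + occurrences [U, D, D] \<gamma>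
    + of_bool (suffix [U, D] \<beta>) + of_bool (suffix [U, D] \<gamma>) + of_bool (\<beta> = [] \<and> \<gamma> = [])"
proof -
  have "prefix [D, D] (\<beta> @ D # \<gamma> @ [D]) \<longleftrightarrow> \<beta> = [] \<and> \<gamma> = []"
    using dyck_not_prefix_D[OF assms(2)] dyck_not_prefix_D[OF assms(3)]
    by (cases \<beta>; cases \<gamma>) auto
  then show ?thesis
    using assms[THEN dyck_not_suffix_U]
    by (simp add: occurrences_append_3 occurrences_Cons occurrences_Nil)
qed

lemma occurrences_UDD_eq_pattern_count:
  assumes "P \<in> dyck_h_geq" "dyck P"
  shows "occurrences [U, D, D] P = pattern_count (phi P)"
  using assms
proof (induction P rule: phi.induct)
  case 1
  then show ?case by (simp add: pattern_count_def occurrences_Nil)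
next
  case (2 \<alpha>)
  have "dyck [U, D]" using dyck_arch[of "[]"] by simp
  then have "\<alpha> \<in> dyck_h_geq"
    using dyck_h_geq_appendD[of \<alpha> "[U, D]"] 2 by simp
  then show ?case
    using 2 dyck_not_suffix_U[of \<alpha>]
    by (simp add: pattern_count_snoc_F phi_last_step occurrences_append_3 occurrences_Cons occurrences_Nil)
next
  case (3 \<alpha> \<beta> \<gamma>)
  let ?\<delta> = "U # \<beta> @ D # \<gamma>"
  have \<delta>: "dyck ?\<delta>" and P: "\<alpha> @ U # ?\<delta> @ [D] \<in> dyck_h_geq"
    using 3 by (simp_all add: dyck_first_return)
  have "\<alpha> \<in> dyck_h_geq" "U # ?\<delta> @ [D] \<in> dyck_h_geq"
    using dyck_h_geq_appendD[OF P] dyck_arch[OF \<delta>] 3 by simp_all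
  moreover from this(2) have "?\<delta> \<in> dyck_h_geq"
    using dyck_h_geq_first_returnD(1)[of ?\<delta> "[]"] \<delta> by simp
  ultimately have mem: "\<alpha> \<in> dyck_h_geq" "\<beta> \<in> dyck_h_geq" "\<gamma> \<in> dyck_h_geq"
    and h: "height \<gamma> \<le> height (U # \<beta> @ [D])"
    using dyck_h_geq_first_returnD[of \<beta> \<gamma>] 3 by simp_all
  have \<alpha>: "\<not> suffix [F] (phi \<alpha>)"
    using not_suffix_UD[OF P] \<delta> 3 suffix_F_phi_iff by simp
  \<comment> \<open>If \<open>\<beta>\<close> is empty, the component before \<open>\<gamma>\<close>
    is \<open>UD\<close>, so \<open>\<gamma>\<close> has height at most 1.\<close>
  have \<gamma>: "suffix [U, D] \<gamma> \<or> \<gamma> = []" if "\<beta> = []"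
    using suffix_UD_if_height_le_1[of \<gamma>] h height_UD that 3 by auto
  \<comment> \<open>No match straddles the end of \<open>phi \<alpha>\<close>. The first two
    indicators come from closing the arch around \<open>phi \<beta>\<close>, the last from the
    junction of \<open>phi \<gamma>\<close> with that arch.\<close>
  have "pattern_count (phi (\<alpha> @ U # ?\<delta> @ [D])) =
      pattern_count (phi \<alpha>) + pattern_count (phi \<gamma>) + pattern_count (phi \<beta>)
      + of_bool (\<beta> = []) + of_bool (suffix [U, D] \<beta>)
      + of_bool (suffix [U, D] \<gamma> \<and> \<beta> \<noteq> [])"
    using 3 by (simp add: phi_append_arch pattern_count_append pattern_count_append_arch pattern_count_arch
        \<alpha> phi_last_step phi_first_step suffix_F_phi_iff phi_eq_Nil_iff)
  \<comment> \<open>For nonempty \<open>\<beta>\<close> the indicators agree term by term. For empty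
    \<open>\<beta>\<close> both sides gain 1, as \<open>\<gamma>\<close> is either empty or ends in
    \<open>UD\<close>.\<close>
  then show ?case
    using 3 mem \<gamma> by (auto simp: occurrences_UDD_arch)
qed simp

theorem theorem9:
  fixes n :: nat and P :: "step list"
  assumes "P \<in> dyck_h_geq_paths n"
  shows "occurrences [U, D, D] P =
           occurrences [F, D] (phi P) + occurrences [U, D] (phi P)
           + occurrences [F, U, U] (phi P) + occurrences [F, U, F] (phi P)"
proof -
  have "P \<in> dyck_h_geq" "dyck P"
    using assms by (auto simp: dyck_h_geq_paths_def dyck_def)
  then show ?thesis
    using occurrences_UDD_eq_pattern_count by (simp add: pattern_count_def)
qed

end
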